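(* Let $g_c(x)=a_c x$ with $a_c>0$ for each class $c\in\mathcal C$, and let $V>0$. Define the limiting throughput of class $c$ as $$\overline{r_c}\triangleq\lim_{t\to\infty}\frac1t\sum_{\tau=0}^{t-1}\mathbb E\Big[\sum_{a:(a,d_c)\in\mathcal L}\widetilde\mu_{ad_c}^{(c)}(\tau)\Big],$$ where $\widetilde\mu_{ad_c}^{(c)}(\tau)$ denotes the class $c$ packets received by node $d_c$ over link $(a,d_c)$ in slot $\tau$. Then the $\mathsf{ORA}$ policy with parameter $V$ (and $\theta_c=a_c$) yields $$\sum_{c\in\mathcal C}a_c\,\overline{r_c}\ \ge\ \sum_{c\in\mathcal C}a_c\,r_c^*-\frac{B}{V},$$ where $(r_c^* )$ is the optimal throughput vector of the optimization problem: maximize $\sum_{c}a_c r_c$ over $(r_c)$, $f_{ab}^{(c)}\ge0$ ($c\in\mathcal C$, $(a,b)\in\mathcal L$) and $q_n^{(c)}\ge0$ ($c\in\mathcal C$, $n\ne d_c$) subject to $r_c=\sum_n\lambda_n^{(c)}-\sum_n q_n^{(c)}$ for all $c$; $\lambda_n^{(c)}+\sum_a f_{an}^{(c)}=q_n^{(c)}+\sum_b f_{nb}^{(c)}$ for all $c$ and $n\ne d_c$; $\sum_c f_{ab}^{(c)}\le\mu_{\max}^{ab}$ for all $(a,b)\in\mathcal L$; and $B$ is the finite constant $$B\triangleq|\mathcal N||\mathcal C|\left[(\mu_{\max}^{\text{out}}+d_{\max})^2+(A_{\max}+\mu_{\max}^{\text{in}})^2+2d_{\max}^2\right].$$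
   Context: Network model. Finite node set $\mathcal N=\{1,\dots,N\}$, set $\mathcal L$ of directed links, finite set $\mathcal C$ of traffic classes; class $c$ has destination $d_c\in\mathcal N$. Time is slotted, $t=0,1,2,\dots$. Exogenous class $c$ arrivals at node $n$ in slot $t$: $A_n^{(c)}(t)\in\{0,\dots,A_{\max}\}$, with $A_{d_c}^{(c)}(t)=0$; they are independent across $c$ and $n\ne d_c$ and i.i.d. over slots with mean $\lambda_n^{(c)}$. Link $(n,m)$ has capacity $\mu_{\max}^{nm}$; a policy allocates service rates $\mu_{nm}^{(c)}(t)\ge0$ with $\sum_c\mu_{nm}^{(c)}(t)\le\mu_{\max}^{nm}$. $\mathcal C_l$ denotes the set of classes having access to link $l$; service rates $\mu_l^{(c)}(t)$ and flow variables $f_l^{(c)}$ are zero for $c\notin\mathcal C_l$, and class $c$ has no access to links leaving $d_c$ (packets leave the network at $d_c$). $Q_n^{(c)}(t)$ is the class $c$ backlog at node $n\ne d_c$, $Q_n^{(c)}(0)=0$; $Q_{d_c}^{(c)}(t)=0$. After transmission in a slot, the queue allocates a drop rate $d_n^{(c)}(t)\in[0,d_{\max}]$; the packets actually dropped are $$\widetilde d_n^{(c)}(t)=\min\Big[\big(Q_n^{(c)}(t)-\sum_b\mu_{nb}^{(c)}(t)\big)^+,\,d_n^{(c)}(t)\Big],\qquad (x)^+=\max(x,0).$$ Let $\widetilde\mu_{nb}^{(c)}(t)$ be the class $c$ packets actually sent over $(n,b)$ in slot $t$: $0\le\widetilde\mu_{nb}^{(c)}(t)\le\mu_{nb}^{(c)}(t)$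 and $\sum_b\widetilde\mu_{nb}^{(c)}(t)=\min[Q_n^{(c)}(t),\sum_b\mu_{nb}^{(c)}(t)]$. Then $$Q_n^{(c)}(t+1)=Q_n^{(c)}(t)-\sum_b\widetilde\mu_{nb}^{(c)}(t)-\widetilde d_n^{(c)}(t)+A_n^{(c)}(t)+\sum_a\widetilde\mu_{an}^{(c)}(t),$$ so that $Q_n^{(c)}(t+1)\le\big[(Q_n^{(c)}(t)-\sum_b\mu_{nb}^{(c)}(t))^+-d_n^{(c)}(t)\big]^++A_n^{(c)}(t)+\sum_a\mu_{an}^{(c)}(t)$. Constants: $\mu_{\max}^{\text{in}}=\max_{n}\sum_{a:(a,n)\in\mathcal L}\mu_{\max}^{an}$, $\mu_{\max}^{\text{out}}=\max_n\sum_{b:(n,b)\in\mathcal L}\mu_{\max}^{nb}$. Standing assumption: $d_{\max}\ge A_{\max}+\mu_{\max}^{\text{in}}$ ($d_{\max}$ finite). Sums over $n$ of class $c$ quantities are over $n\ne d_c$. Data amounts are nonnegative reals. Drop queues: for each $c$ and $n\ne d_c$, $D_n^{(c)}(0)=V\theta_c$ and $D_n^{(c)}(t+1)=[D_n^{(c)}(t)-\varphi_n^{(c)}(t)]^++\widetilde d_n^{(c)}(t)$, with $\varphi_n^{(c)}(t)\in[0,d_{\max}]$. $\mathsf{ORA}$ policy (parameters $V>0$, $\theta_c=a_c$), in every slot $t$: (1) Backpressure routing: for each link $l=(n,m)$, compute $W_l^{(c)}(t)=Q_n^{(c)}(t)-Q_m^{(c)}(t)$ for $c\in\mathcal C_l$,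 and let $c_l^*(t)$ maximize $W_l^{(c)}(t)$ over $c\in\mathcal C_l$ (ties arbitrary). Set $\mu_{nm}^{(c_l^*(t))}(t)=\mu_{\max}^{nm}$ if $\max_{c\in\mathcal C_l}W_l^{(c)}(t)>0$ and $0$ otherwise; set $\mu_{nm}^{(c)}(t)=0$ for all other classes. (2) Packet dropping: $d_n^{(c)}(t)=d_{\max}$ if $Q_n^{(c)}(t)>D_n^{(c)}(t)$ and $0$ otherwise; $\varphi_n^{(c)}(t)=d_{\max}$ if $D_n^{(c)}(t)>V\theta_c$ and $0$ otherwise. (3) Queue update: for each $c$ and $n\ne d_c$, set $Q_n^{(c)}(t+1)=Q_n^{(c)}(t)-\sum_b\widetilde\mu_{nb}^{(c)}(t)-\widetilde d_n^{(c)}(t)+A_n^{(c)}(t)+\sum_a\widetilde\mu_{an}^{(c)}(t)$ and $D_n^{(c)}(t+1)=[D_n^{(c)}(t)-\varphi_n^{(c)}(t)]^++\widetilde d_n^{(c)}(t)$. The limits defining $\overline{r_c}$ are presumed to exist. *)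

theory Defs
  imports "HOL-Probability.Probability"
begin

record ('v, 'c) network_data =
  nodes :: "'v set"
  links :: "('v \<times> 'v) set"
  classes :: "'c set"
  dest :: "'c \<Rightarrow> 'v"
  access :: "'v \<times> 'v \<Rightarrow> 'c set"  \<comment> \<open>the classes that may use a link\<close>
  capacity :: "'v \<times> 'v \<Rightarrow> real"

locale network =
  fixes G :: "('v, 'c) network_data"
  assumes finite_nodes: "finite (nodes G)"
    and nodes_nonempty: "nodes G \<noteq> {}"
    and links_subset: "links G \<subseteq> nodes G \<times> nodes G"
    and finite_classes: "finite (classes G)"
    and dest_node: "c \<in> classes G \<Longrightarrow> dest G c \<in> nodes G"
    and access_classes: "l \<in> links G \<Longrightarrow> access G l \<subseteq> classes G"
    and no_access_from_dest: "(n, m) \<in> links G \<Longrightarrow> c \<in> access G (n, m) \<Longrightarrow> n \<noteq> dest G c"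
    and capacity_nonneg: "l \<in> links G \<Longrightarrow> 0 \<le> capacity G l"

text \<open>The pairs of a class and a node other than its destination.\<close>

definition sources :: "('v, 'c) network_data \<Rightarrow> ('c \<times> 'v) set" where
  "sources G = {(c, n). c \<in> classes G \<and> n \<in> nodes G \<and> n \<noteq> dest G c}"

definition inflow :: "('v, 'c) network_data \<Rightarrow> ('v \<times> 'v \<Rightarrow> real) \<Rightarrow> 'v \<Rightarrow> real" where
  "inflow G x n = (\<Sum>a | (a, n) \<in> links G. x (a, n))"

definition outflow :: "('v, 'c) network_data \<Rightarrow> ('v \<times> 'v \<Rightarrow> real) \<Rightarrow> 'v \<Rightarrow> real" where
  "outflow G x n = (\<Sum>b | (n, b) \<in> links G. x (n, b))"

definition mu_in :: "('v, 'c) network_data \<Rightarrow> real" where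
  "mu_in G = Max (inflow G (capacity G) ` nodes G)"

definition mu_out :: "('v, 'c) network_data \<Rightarrow> real" where
  "mu_out G = Max (outflow G (capacity G) ` nodes G)"


text \<open>
  The throughput optimization problem. Its variables are the throughputs \<open>r\<close>, the flows
  \<open>f c l\<close> and the rates \<open>q c n\<close> at which class \<open>c\<close> traffic is discarded at node \<open>n\<close>.
\<close>

definition feasible ::
    "('v, 'c) network_data \<Rightarrow> ('c \<Rightarrow> 'v \<Rightarrow> real) \<Rightarrow> ('c \<Rightarrow> real)
      \<Rightarrow> ('c \<Rightarrow> 'v \<times> 'v \<Rightarrow> real) \<Rightarrow> ('c \<Rightarrow> 'v \<Rightarrow> real) \<Rightarrow> bool" where
  "feasible G lam r f q \<longleftrightarrow>
     (\<forall>c\<in>classes G. \<forall>l\<in>links G. 0 \<le> f c l \<and> (c \<notin> access G l \<longrightarrow> f c l = 0)) \<and>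
     (\<forall>(c, n)\<in>sources G. 0 \<le> q c n) \<and>
     (\<forall>c\<in>classes G. r c = (\<Sum>n\<in>nodes G - {dest G c}. lam c n) - (\<Sum>n\<in>nodes G - {dest G c}. q c n)) \<and>
     (\<forall>(c, n)\<in>sources G. lam c n + inflow G (f c) n = q c n + outflow G (f c) n) \<and>
     (\<forall>l\<in>links G. (\<Sum>c\<in>classes G. f c l) \<le> capacity G l)"

definition optimal_throughput ::
    "('v, 'c) network_data \<Rightarrow> ('c \<Rightarrow> 'v \<Rightarrow> real) \<Rightarrow> ('c \<Rightarrow> real) \<Rightarrow> ('c \<Rightarrow> real) \<Rightarrow> bool" where
  "optimal_throughput G lam a r \<longleftrightarrow>
     is_arg_max (\<lambda>r. \<Sum>c\<in>classes G. a c * r c) (\<lambda>r. \<exists>f q. feasible G lam r f q) r"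


definition backlog_diff :: "('c \<Rightarrow> 'v \<Rightarrow> real) \<Rightarrow> 'v \<times> 'v \<Rightarrow> 'c \<Rightarrow> real" where
  "backlog_diff Q l c = Q c (fst l) - Q c (snd l)"

text \<open>
  One sample path of the network under the ORA policy. The link choices \<open>cs\<close> are any maximizers
  of the differential backlog, and the packets \<open>sent\<close> are any division of the transmitted data
  over the outgoing links; both are given processes rather than functions of the state.
\<close>

locale ora_path = network G for G :: "('v, 'c) network_data" +
  fixes d_max V :: real
    and theta :: "'c \<Rightarrow> real"
    and A :: "nat \<Rightarrow> 'c \<Rightarrow> 'v \<Rightarrow> nat"
    and cs :: "nat \<Rightarrow> 'v \<times> 'v \<Rightarrow> 'c"
    and mu sent :: "nat \<Rightarrow> 'c \<Rightarrow> 'v \<times> 'v \<Rightarrow> real"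
    and d dropped phi Q D :: "nat \<Rightarrow> 'c \<Rightarrow> 'v \<Rightarrow> real"
  assumes Q_dest: "c \<in> classes G \<Longrightarrow> Q t c (dest G c) = 0"
    and Q_init: "(c, n) \<in> sources G \<Longrightarrow> Q 0 c n = 0"
    and D_init: "(c, n) \<in> sources G \<Longrightarrow> D 0 c n = V * theta c"
    and cs_max: "l \<in> links G \<Longrightarrow> access G l \<noteq> {} \<Longrightarrow>
      is_arg_max (backlog_diff (Q t) l) (\<lambda>c. c \<in> access G l) (cs t l)"
    and mu_eq: "l \<in> links G \<Longrightarrow> c \<in> classes G \<Longrightarrow>
      mu t c l =
        (if access G l \<noteq> {} \<and> c = cs t l \<and> Max (backlog_diff (Q t) l ` access G l) > 0
         then capacity G l else 0)"
    and sent_bounds: "l \<in> links G \<Longrightarrow> c \<in> classes G \<Longrightarrow> 0 \<le> sent t c l \<and> sent t c l \<le> mu t c l"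
    and sent_total: "c \<in> classes G \<Longrightarrow> n \<in> nodes G \<Longrightarrow>
      outflow G (sent t c) n = min (Q t c n) (outflow G (mu t c) n)"
    and d_eq: "(c, n) \<in> sources G \<Longrightarrow> d t c n = (if Q t c n > D t c n then d_max else 0)"
    and phi_eq: "(c, n) \<in> sources G \<Longrightarrow> phi t c n = (if D t c n > V * theta c then d_max else 0)"
    and dropped_eq: "(c, n) \<in> sources G \<Longrightarrow>
      dropped t c n = min (max (Q t c n - outflow G (mu t c) n) 0) (d t c n)"
    and Q_step: "(c, n) \<in> sources G \<Longrightarrow>
      Q (Suc t) c n =
        Q t c n - outflow G (sent t c) n - dropped t c n + real (A t c n) + inflow G (sent t c) n"
    and D_step: "(c, n) \<in> sources G \<Longrightarrow>
      D (Suc t) c n = max (D t c n - phi t c n) 0 + dropped t c n"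


locale arrivals = prob_space M + network G
  for M :: "'w measure" and G :: "('v, 'c) network_data" +
  fixes A :: "'w \<Rightarrow> nat \<Rightarrow> 'c \<Rightarrow> 'v \<Rightarrow> nat"
    and A_max :: nat
    and lam :: "'c \<Rightarrow> 'v \<Rightarrow> real"
  assumes A_le: "\<omega> \<in> space M \<Longrightarrow> (c, n) \<in> sources G \<Longrightarrow> A \<omega> t c n \<le> A_max"
    and A_dest: "\<omega> \<in> space M \<Longrightarrow> c \<in> classes G \<Longrightarrow> A \<omega> t c (dest G c) = 0"
    and A_indep: "indep_vars (\<lambda>_. count_space UNIV) (\<lambda>(t, c, n) \<omega>. A \<omega> t c n) (UNIV \<times> sources G)"
    and A_ident: "(c, n) \<in> sources G \<Longrightarrow>
      distr M (count_space UNIV) (\<lambda>\<omega>. A \<omega> t c n) = distr M (count_space UNIV) (\<lambda>\<omega>. A \<omega> 0 c n)"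
    and A_mean: "(c, n) \<in> sources G \<Longrightarrow> expectation (\<lambda>\<omega>. real (A \<omega> t c n)) = lam c n"

text \<open>
  Ties in the routing decision are broken, and transmitted data divided over links, in an arbitrary
  (possibly randomized) but nonanticipating way: \<open>F t\<close> is the information available in slot \<open>t\<close>
  before that slot's arrivals, and is independent of them.
\<close>

locale ora_policy = arrivals M G A A_max lam + filtration "space M" F
  for M :: "'w measure" and G :: "('v, 'c) network_data"
    and A :: "'w \<Rightarrow> nat \<Rightarrow> 'c \<Rightarrow> 'v \<Rightarrow> nat" and A_max :: nat and lam :: "'c \<Rightarrow> 'v \<Rightarrow> real"
    and F :: "nat \<Rightarrow> 'w measure" +
  fixes d_max V :: real
    and theta :: "'c \<Rightarrow> real"
    and cs :: "'w \<Rightarrow> nat \<Rightarrow> 'v \<times> 'v \<Rightarrow> 'c"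
    and mu sent :: "'w \<Rightarrow> nat \<Rightarrow> 'c \<Rightarrow> 'v \<times> 'v \<Rightarrow> real"
    and d dropped phi Q D :: "'w \<Rightarrow> nat \<Rightarrow> 'c \<Rightarrow> 'v \<Rightarrow> real"
  assumes d_max_ge: "d_max \<ge> real A_max + mu_in G"
    and path: "\<omega> \<in> space M \<Longrightarrow>
      ora_path G d_max V theta (A \<omega>) (cs \<omega>) (mu \<omega>) (sent \<omega>) (d \<omega>) (dropped \<omega>) (phi \<omega>) (Q \<omega>) (D \<omega>)"
    and F_subalgebra: "subalgebra M (F t)"
    and A_past: "(c, n) \<in> sources G \<Longrightarrow> (\<lambda>\<omega>. A \<omega> t c n) \<in> measurable (F (Suc t)) (count_space UNIV)"
    and cs_adapted: "l \<in> links G \<Longrightarrow> access G l \<noteq> {} \<Longrightarrow>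
      (\<lambda>\<omega>. cs \<omega> t l) \<in> measurable (F t) (count_space UNIV)"
    and sent_adapted: "l \<in> links G \<Longrightarrow> c \<in> classes G \<Longrightarrow>
      (\<lambda>\<omega>. sent \<omega> t c l) \<in> borel_measurable (F t)"
    and A_indep_past: "indep_set (sets (F t))
      (sets (vimage_algebra (space M)
        (\<lambda>\<omega>. restrict (\<lambda>(c, n). A \<omega> t c n) (sources G))
        (\<Pi>\<^sub>M _\<in>sources G. count_space UNIV)))"


definition avg_throughput ::
    "'w measure \<Rightarrow> ('v, 'c) network_data \<Rightarrow> ('w \<Rightarrow> nat \<Rightarrow> 'c \<Rightarrow> 'v \<times> 'v \<Rightarrow> real)
      \<Rightarrow> 'c \<Rightarrow> nat \<Rightarrow> real" where
  "avg_throughput M G sent c t =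
     1 / real t * (\<Sum>\<tau><t. \<integral>\<omega>. inflow G (sent \<omega> \<tau> c) (dest G c) \<partial>M)"

definition throughput ::
    "'w measure \<Rightarrow> ('v, 'c) network_data \<Rightarrow> ('w \<Rightarrow> nat \<Rightarrow> 'c \<Rightarrow> 'v \<times> 'v \<Rightarrow> real) \<Rightarrow> 'c \<Rightarrow> real" where
  "throughput M G sent c = lim (avg_throughput M G sent c)"

definition ora_gap :: "('v, 'c) network_data \<Rightarrow> nat \<Rightarrow> real \<Rightarrow> real" where
  "ora_gap G A_max d_max =
     real (card (nodes G)) * real (card (classes G)) *
       ((mu_out G + d_max)\<^sup>2 + (real A_max + mu_in G)\<^sup>2 + 2 * d_max\<^sup>2)"

end

theory Submission
  imports Defs
begin

text \<open>
  The proof is a Lyapunov drift argument, carried out on each sample path and integrated only at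
  the end. The drop queue \<open>D\<close> is a virtual copy of the dropped traffic: in each slot it receives
  what the data queue \<open>Q\<close> drops and is served at the rate \<open>\<phi>\<close>. Adding the penalty
  \<open>2 V \<Sum> \<theta> \<phi>\<close> to the one-slot change of \<open>\<Sum> Q\<^sup>2 + D\<^sup>2\<close> gives a bound in which the routing, the drop
  rates \<open>d\<close> and the service rates \<open>\<phi>\<close> occur in separate linear terms. ORA optimizes each of these
  terms for the current backlogs (\<open>backpressure_net_outflow\<close>, \<open>drop_rules_maximal\<close>). Its bound is
  therefore at least as good as the one obtained from a feasible point \<open>(f, q)\<close> of the throughput
  problem with service \<open>f\<close> on the links and \<open>d = \<phi> = q\<close>. These drop rates are permitted, since
  \<open>q \<le> A_max + mu_in \<le> d_max\<close>. For \<open>(f, q)\<close> flow conservation turns every term linear in \<open>Q\<close> into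
  the noise \<open>Q (A - \<lambda>)\<close>, and the terms linear in \<open>D\<close> cancel (\<open>drift_plus_penalty\<close>).

  What the network delivers equals the arrivals minus the drops and the growth of the backlog, and
  the drops are at most the total of \<open>\<phi>\<close> plus the growth of \<open>D\<close>. The growth terms are linear in
  \<open>Q\<close> and \<open>D\<close> with coefficient \<open>\<theta>\<close>. Completing the square absorbs them into the nonnegative function
  \<open>\<Sum> (Q - V \<theta>)\<^sup>2 + (D - V \<theta>)\<^sup>2\<close>, which telescopes with a bounded cost independent of the time
  horizon (\<open>delivered_step\<close>, \<open>delivered_total\<close>).

  In expectation the noise vanishes, because the backlogs of a slot are determined by the past and
  the arrivals of the slot are independent of it (\<open>backlog_arrival_cross_term\<close>). Dividing by the
  horizon and passing to the limit leaves the optimal value minus half of the gap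
  (\<open>throughput_ge_half_gap\<close>), the factor one half coming from dividing the drift of the squares
  by \<open>2 V\<close>.
\<close>


section \<open>Flows on the network\<close>

context network
begin

lemma finite_links: "finite (links G)"
  using links_subset finite_nodes by (meson finite_SigmaI finite_subset)

lemma sources_Sigma: "sources G = (SIGMA c:classes G. nodes G - {dest G c})"
  by (auto simp: sources_def)

lemma sum_sources:
  fixes h :: "'c \<Rightarrow> 'v \<Rightarrow> real"
  shows "(\<Sum>(c, n)\<in>sources G. h c n) = (\<Sum>c\<in>classes G. \<Sum>n\<in>nodes G - {dest G c}. h c n)"
  unfolding sources_Sigma using finite_nodes finite_classes by (subst sum.Sigma) auto

lemma card_sources_le: "card (sources G) \<le> card (nodes G) * card (classes G)"
proof -
  have "sources G \<subseteq> classes G \<times> nodes G" by (auto simp: sources_def)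
  then have "card (sources G) \<le> card (classes G \<times> nodes G)"
    using finite_nodes finite_classes by (intro card_mono) auto
  then show ?thesis by (simp add: card_cartesian_product mult.commute)
qed

lemma inflow_links: "inflow G x n = (\<Sum>l | l \<in> links G \<and> snd l = n. x l)"
  unfolding inflow_def by (rule sum.reindex_bij_witness[of _ fst "\<lambda>a. (a, n)"]) auto

lemma outflow_links: "outflow G x n = (\<Sum>l | l \<in> links G \<and> fst l = n. x l)"
  unfolding outflow_def by (rule sum.reindex_bij_witness[of _ snd "\<lambda>b. (n, b)"]) auto

lemma sum_weighted_inflow:
  "(\<Sum>n\<in>nodes G. w n * inflow G x n) = (\<Sum>l\<in>links G. w (snd l) * x l)"
proof -
  have "(\<Sum>n\<in>nodes G. w n * inflow G x n)
      = (\<Sum>n\<in>nodes G. \<Sum>l | l \<in> links G \<and> snd l = n. w (snd l) * x l)"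
    by (simp add: inflow_links sum_distrib_left)
  also have "\<dots> = (\<Sum>l\<in>links G. w (snd l) * x l)"
    using links_subset by (intro sum.group finite_links finite_nodes) auto
  finally show ?thesis .
qed

lemma sum_weighted_outflow:
  "(\<Sum>n\<in>nodes G. w n * outflow G x n) = (\<Sum>l\<in>links G. w (fst l) * x l)"
proof -
  have "(\<Sum>n\<in>nodes G. w n * outflow G x n)
      = (\<Sum>n\<in>nodes G. \<Sum>l | l \<in> links G \<and> fst l = n. w (fst l) * x l)"
    by (simp add: outflow_links sum_distrib_left)
  also have "\<dots> = (\<Sum>l\<in>links G. w (fst l) * x l)"
    using links_subset by (intro sum.group finite_links finite_nodes) auto
  finally show ?thesis .
qed

text \<open>
  Summation by parts over the links. It turns backlogs weighted by net outflows into link flows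
  weighted by differential backlogs, the quantity that the routing rule maximizes link by link.
\<close>

lemma sum_net_outflow_eq_sum_links:
  assumes c: "c \<in> classes G" and w: "w (dest G c) = 0"
  shows "(\<Sum>n\<in>nodes G - {dest G c}. w n * (outflow G x n - inflow G x n))
    = (\<Sum>l\<in>links G. (w (fst l) - w (snd l)) * x l)"
proof -
  have "(\<Sum>n\<in>nodes G - {dest G c}. w n * (outflow G x n - inflow G x n))
      = (\<Sum>n\<in>nodes G. w n * (outflow G x n - inflow G x n))"
    using finite_nodes dest_node[OF c] w by (subst (2) sum.remove[of _ "dest G c"]) auto
  also have "\<dots> = (\<Sum>l\<in>links G. w (fst l) * x l) - (\<Sum>l\<in>links G. w (snd l) * x l)"
    by (simp add: right_diff_distrib sum_subtractf sum_weighted_inflow sum_weighted_outflow)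
  finally show ?thesis by (simp add: left_diff_distrib sum_subtractf)
qed

text \<open>
  Summed over all nodes, net outflows cancel. What leaves the sources therefore reaches the
  destination, as nothing flows out of it.
\<close>

lemma sum_net_inflow_eq_delivered:
  assumes c: "c \<in> classes G" and out: "outflow G x (dest G c) = 0"
  shows "(\<Sum>n\<in>nodes G - {dest G c}. outflow G x n - inflow G x n) = inflow G x (dest G c)"
proof -
  have "(\<Sum>n\<in>nodes G. outflow G x n) = (\<Sum>n\<in>nodes G. inflow G x n)"
    using sum_weighted_inflow[of "\<lambda>_. 1" x] sum_weighted_outflow[of "\<lambda>_. 1" x] by simp
  moreover have "(\<Sum>n\<in>nodes G. outflow G x n - inflow G x n)
      = outflow G x (dest G c) - inflow G x (dest G c)
        + (\<Sum>n\<in>nodes G - {dest G c}. outflow G x n - inflow G x n)"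
    using finite_nodes dest_node[OF c] by (subst sum.remove[of _ "dest G c"]) auto
  ultimately show ?thesis using out by (simp add: sum_subtractf)
qed

lemma inflow_mono: "(\<And>l. l \<in> links G \<Longrightarrow> x l \<le> y l) \<Longrightarrow> inflow G x n \<le> inflow G y n"
  unfolding inflow_def by (rule sum_mono) auto

lemma outflow_mono: "(\<And>l. l \<in> links G \<Longrightarrow> x l \<le> y l) \<Longrightarrow> outflow G x n \<le> outflow G y n"
  unfolding outflow_def by (rule sum_mono) auto

lemma inflow_nonneg: "(\<And>l. l \<in> links G \<Longrightarrow> 0 \<le> x l) \<Longrightarrow> 0 \<le> inflow G x n"
  unfolding inflow_def by (rule sum_nonneg) auto

lemma outflow_nonneg: "(\<And>l. l \<in> links G \<Longrightarrow> 0 \<le> x l) \<Longrightarrow> 0 \<le> outflow G x n"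
  unfolding outflow_def by (rule sum_nonneg) auto

lemma inflow_le_mu_in:
  assumes "n \<in> nodes G" and "\<And>l. l \<in> links G \<Longrightarrow> x l \<le> capacity G l"
  shows "inflow G x n \<le> mu_in G"
proof -
  have "inflow G (capacity G) n \<le> mu_in G"
    unfolding mu_in_def using finite_nodes assms(1) by (intro Max_ge) auto
  then show ?thesis using inflow_mono[of x "capacity G" n, OF assms(2)] by linarith
qed

lemma outflow_le_mu_out:
  assumes "n \<in> nodes G" and "\<And>l. l \<in> links G \<Longrightarrow> x l \<le> capacity G l"
  shows "outflow G x n \<le> mu_out G"
proof -
  have "outflow G (capacity G) n \<le> mu_out G"
    unfolding mu_out_def using finite_nodes assms(1) by (intro Max_ge) auto
  then show ?thesis using outflow_mono[of x "capacity G" n, OF assms(2)] by linarith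
qed

lemma mu_in_nonneg: "0 \<le> mu_in G"
proof -
  obtain n where "n \<in> nodes G" using nodes_nonempty by auto
  then show ?thesis
    using inflow_le_mu_in[of n "capacity G"] inflow_nonneg[of "capacity G" n] capacity_nonneg
    by fastforce
qed

lemma feasible_flow_le_capacity:
  assumes "feasible G lam r f q" "c \<in> classes G" "l \<in> links G"
  shows "f c l \<le> capacity G l"
proof -
  have "f c l \<le> (\<Sum>c\<in>classes G. f c l)"
    using assms finite_classes by (intro member_le_sum) (auto simp: feasible_def)
  then show ?thesis using assms by (auto simp: feasible_def intro: order_trans)
qed

end


section \<open>Drift along a sample path\<close>

text \<open>
  Squaring the update of a queue with backlog \<open>x\<close>, offered service \<open>y\<close> and new data \<open>z\<close>: truncating
  \<open>x - y\<close> at zero cannot increase its square, and in the cross term the remaining backlog is at most \<open>x\<close>.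
\<close>

lemma queue_square_drift:
  fixes x y z :: real
  assumes "0 \<le> x" "0 \<le> y" "0 \<le> z"
  shows "(max (x - y) 0 + z)\<^sup>2 \<le> x\<^sup>2 + y\<^sup>2 + z\<^sup>2 - 2 * x * (y - z)"
proof -
  have "(max (x - y) 0)\<^sup>2 \<le> (x - y)\<^sup>2" by (auto simp: max_def)
  moreover have "z * max (x - y) 0 \<le> z * x" using assms by (intro mult_left_mono) auto
  ultimately show ?thesis by (simp add: power2_eq_square algebra_simps)
qed

text \<open>
  The consequences of the policy that hold on every single sample path. Probability enters
  afterwards, by integrating the inequalities established here.
\<close>

locale ora_run = ora_path G d_max V theta A cs mu sent d dropped phi Q D
  for G :: "('v, 'c) network_data" and d_max V theta A cs mu sent d dropped phi Q D +
  fixes A_max :: nat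
  assumes V_pos: "V > 0"
    and theta_pos: "c \<in> classes G \<Longrightarrow> theta c > 0"
    and A_le_A_max: "(c, n) \<in> sources G \<Longrightarrow> A t c n \<le> A_max"
    and d_max_large: "d_max \<ge> real A_max + mu_in G"
begin

lemma d_max_nonneg: "0 \<le> d_max"
  using d_max_large mu_in_nonneg by simp

lemma sourceD:
  assumes "(c, n) \<in> sources G"
  shows "c \<in> classes G" "n \<in> nodes G" "n \<noteq> dest G c"
  using assms by (auto simp: sources_def)

lemma d_bounds: "(c, n) \<in> sources G \<Longrightarrow> 0 \<le> d t c n \<and> d t c n \<le> d_max"
  using d_eq d_max_nonneg by simp

lemma phi_bounds: "(c, n) \<in> sources G \<Longrightarrow> 0 \<le> phi t c n \<and> phi t c n \<le> d_max"
  using phi_eq d_max_nonneg by simp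

lemma dropped_bounds: "(c, n) \<in> sources G \<Longrightarrow> 0 \<le> dropped t c n \<and> dropped t c n \<le> d t c n"
  using dropped_eq[of c n t] d_bounds[of c n t] by auto

lemma mu_bounds:
  "l \<in> links G \<Longrightarrow> c \<in> classes G \<Longrightarrow> 0 \<le> mu t c l \<and> mu t c l \<le> capacity G l"
  using mu_eq capacity_nonneg by auto

lemma sent_le_capacity: "l \<in> links G \<Longrightarrow> c \<in> classes G \<Longrightarrow> sent t c l \<le> capacity G l"
  using sent_bounds mu_bounds by (meson order_trans)

lemma Q_nonneg: "(c, n) \<in> sources G \<Longrightarrow> 0 \<le> Q t c n"
proof (induction t)
  case 0
  then show ?case using Q_init by simp
next
  case (Suc t)
  note src = sourceD[OF Suc.prems]
  have "0 \<le> inflow G (sent t c) n" using sent_bounds src by (intro inflow_nonneg) auto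
  moreover have "Q t c n - outflow G (sent t c) n - dropped t c n \<ge> 0"
    unfolding sent_total[OF src(1,2)] dropped_eq[OF Suc.prems] by (auto simp: min_def max_def)
  ultimately show ?case using Q_step[OF Suc.prems] by simp
qed

lemma D_nonneg: "(c, n) \<in> sources G \<Longrightarrow> 0 \<le> D t c n"
proof (cases t)
  case 0
  assume "(c, n) \<in> sources G"
  then show ?thesis using 0 D_init V_pos theta_pos sourceD(1) by (fastforce intro: less_imp_le)
next
  case (Suc s)
  assume "(c, n) \<in> sources G"
  then show ?thesis using Suc D_step dropped_bounds by (simp add: add_nonneg_nonneg)
qed

text \<open>
  Expressing the drops through the data sent instead of the allocated rates keeps the link
  choices out of the backlog recursion, so that its measurability rests on that of the data sent.
\<close>

lemma dropped_eq_sent: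
  assumes "(c, n) \<in> sources G"
  shows "dropped t c n = min (Q t c n - outflow G (sent t c) n) (d t c n)"
  unfolding sent_total[OF sourceD(1,2)[OF assms]] dropped_eq[OF assms]
  by (auto simp: min_def max_def)

text \<open>
  In this form the update is that of a single queue whose offered service is the sum of link
  service and drop rate, which is what \<open>queue_square_drift\<close> expects.
\<close>

lemma Q_step_max:
  assumes "(c, n) \<in> sources G"
  shows "Q (Suc t) c n =
    max (Q t c n - (outflow G (mu t c) n + d t c n)) 0 + (real (A t c n) + inflow G (sent t c) n)"
  unfolding Q_step[OF assms] sent_total[OF sourceD(1,2)[OF assms]] dropped_eq[OF assms]
  using d_bounds[OF assms, of t] by (auto simp: min_def max_def)

text \<open>
  A crude bound, growing with time; it is only meant to make the backlogs integrable.
\<close>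

lemma Q_le: "(c, n) \<in> sources G \<Longrightarrow> Q t c n \<le> real t * d_max"
proof (induction t)
  case 0
  then show ?case using Q_init by simp
next
  case (Suc t)
  note src = sourceD[OF Suc.prems]
  have "inflow G (sent t c) n \<le> mu_in G"
    using src sent_le_capacity by (intro inflow_le_mu_in) auto
  moreover have "real (A t c n) \<le> real A_max" using A_le_A_max[OF Suc.prems] by simp
  moreover have "0 \<le> outflow G (mu t c) n" using src mu_bounds by (intro outflow_nonneg) auto
  moreover have "max (Q t c n - (outflow G (mu t c) n + d t c n)) 0 \<le> Q t c n"
    using calculation(3) d_bounds[OF Suc.prems, of t] Q_nonneg[OF Suc.prems, of t] by simp
  moreover have "real (Suc t) * d_max = real t * d_max + d_max"
    by (simp add: algebra_simps)
  ultimately show ?case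
    using Q_step_max[OF Suc.prems, of t] Suc.IH[OF Suc.prems] d_max_large by linarith
qed

lemma dest_outflow_sent: "c \<in> classes G \<Longrightarrow> outflow G (sent t c) (dest G c) = 0"
  using sent_total[of c "dest G c" t] Q_dest[of c t] dest_node[of c]
    outflow_nonneg[of "mu t c" "dest G c"] mu_bounds[of _ c t]
  by auto

text \<open>
  The routing rule gives the whole capacity of a link to its largest positive differential
  backlog, and no division of the capacity between classes can weigh more.
\<close>

lemma backpressure_maximal:
  assumes l: "l \<in> links G"
    and x0: "\<And>c. c \<in> classes G \<Longrightarrow> 0 \<le> x c"
    and xacc: "\<And>c. c \<in> classes G \<Longrightarrow> c \<notin> access G l \<Longrightarrow> x c = 0"
    and xcap: "(\<Sum>c\<in>classes G. x c) \<le> capacity G l"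
  shows "(\<Sum>c\<in>classes G. backlog_diff (Q t) l c * x c)
    \<le> (\<Sum>c\<in>classes G. backlog_diff (Q t) l c * mu t c l)"
proof (cases "access G l = {}")
  case True
  then show ?thesis using xacc mu_eq[OF l] by simp
next
  case False
  let ?W = "backlog_diff (Q t) l"
  define c' where "c' = cs t l"
  have c': "c' \<in> access G l" "\<And>c. c \<in> access G l \<Longrightarrow> ?W c \<le> ?W c'"
    using cs_max[OF l False, of t] unfolding is_arg_max_def c'_def by (auto simp: not_less)
  have acc: "access G l \<subseteq> classes G" using access_classes[OF l] .
  then have "finite (access G l)" using finite_classes finite_subset by blast
  then have Max: "Max (?W ` access G l) = ?W c'" using c' by (intro Max_eqI) auto
  have "(\<Sum>c\<in>classes G. ?W c * x c) \<le> (\<Sum>c\<in>classes G. max (?W c') 0 * x c)"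
  proof (rule sum_mono)
    fix c assume c: "c \<in> classes G"
    show "?W c * x c \<le> max (?W c') 0 * x c"
    proof (cases "c \<in> access G l")
      case True
      then show ?thesis using c'(2)[OF True] x0[OF c]
        by (intro mult_right_mono) (simp_all add: le_max_iff_disj)
    next
      case False
      then show ?thesis using xacc[OF c] by simp
    qed
  qed
  also have "\<dots> \<le> max (?W c') 0 * capacity G l"
    unfolding sum_distrib_left[symmetric] using xcap by (intro mult_left_mono) auto
  also have "\<dots> = (\<Sum>c\<in>classes G. if c = c' then max (?W c') 0 * capacity G l else 0)"
    using c'(1) acc finite_classes by (simp add: subset_iff)
  also have "\<dots> = (\<Sum>c\<in>classes G. ?W c * mu t c l)"
    using mu_eq[OF l, of _ t] False Max by (intro sum.cong) (auto simp: c'_def max_def)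
  finally show ?thesis .
qed

lemma backpressure_net_outflow:
  assumes feas: "feasible G lam r f q"
  shows "(\<Sum>(c, n)\<in>sources G. Q t c n * (outflow G (f c) n - inflow G (f c) n))
    \<le> (\<Sum>(c, n)\<in>sources G. Q t c n * (outflow G (mu t c) n - inflow G (mu t c) n))"
proof -
  have parts: "(\<Sum>(c, n)\<in>sources G. Q t c n * (outflow G (x c) n - inflow G (x c) n))
      = (\<Sum>l\<in>links G. \<Sum>c\<in>classes G. backlog_diff (Q t) l c * x c l)" for x
  proof -
    have "(\<Sum>(c, n)\<in>sources G. Q t c n * (outflow G (x c) n - inflow G (x c) n))
        = (\<Sum>c\<in>classes G. \<Sum>l\<in>links G. backlog_diff (Q t) l c * x c l)"
      unfolding sum_sources backlog_diff_def
      using Q_dest by (intro sum.cong refl sum_net_outflow_eq_sum_links) auto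
    then show ?thesis by (subst sum.swap) simp
  qed
  show ?thesis
    unfolding parts using feas
    by (intro sum_mono backpressure_maximal) (auto simp: feasible_def)
qed

definition drift_const :: real where
  "drift_const = (mu_out G + d_max)\<^sup>2 + (real A_max + mu_in G)\<^sup>2 + 2 * d_max\<^sup>2"

text \<open>
  Both queues of a source are bounded by \<open>queue_square_drift\<close>. The drop queue actually receives
  the dropped amount, which the drop rate \<open>d\<close> dominates; with \<open>d\<close> in both bounds, the two terms
  containing it combine to the factor \<open>Q - D\<close> that the dropping rule looks at.
\<close>

lemma backlog_drift:
  assumes s: "(c, n) \<in> sources G"
  shows "(Q (Suc t) c n)\<^sup>2 + (D (Suc t) c n)\<^sup>2
    \<le> (Q t c n)\<^sup>2 + (D t c n)\<^sup>2 + drift_const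
      - 2 * Q t c n * (outflow G (mu t c) n - inflow G (mu t c) n - real (A t c n))
      - 2 * (Q t c n - D t c n) * d t c n - 2 * D t c n * phi t c n"
proof -
  note src = sourceD[OF s]
  let ?o = "outflow G (mu t c) n" and ?i = "inflow G (mu t c) n" and ?a = "real (A t c n)"
  have o: "0 \<le> ?o" "?o \<le> mu_out G"
    using src mu_bounds by (auto intro!: outflow_nonneg outflow_le_mu_out)
  have i: "0 \<le> ?i" "?i \<le> mu_in G"
    using src mu_bounds by (auto intro!: inflow_nonneg inflow_le_mu_in)
  have a: "?a \<le> real A_max" using A_le_A_max[OF s] by simp
  have d: "0 \<le> d t c n" "d t c n \<le> d_max" and phi: "0 \<le> phi t c n" "phi t c n \<le> d_max"
    using d_bounds[OF s] phi_bounds[OF s] by auto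
  have "inflow G (sent t c) n \<le> ?i" using sent_bounds src by (intro inflow_mono) auto
  then have "Q (Suc t) c n \<le> max (Q t c n - (?o + d t c n)) 0 + (?a + ?i)"
    unfolding Q_step_max[OF s] by simp
  then have "(Q (Suc t) c n)\<^sup>2 \<le> (max (Q t c n - (?o + d t c n)) 0 + (?a + ?i))\<^sup>2"
    using Q_nonneg[OF s] by (intro power_mono) auto
  also have "\<dots> \<le> (Q t c n)\<^sup>2 + (?o + d t c n)\<^sup>2 + (?a + ?i)\<^sup>2
      - 2 * Q t c n * ((?o + d t c n) - (?a + ?i))"
    using o i d Q_nonneg[OF s] by (intro queue_square_drift) auto
  also have "(?o + d t c n)\<^sup>2 \<le> (mu_out G + d_max)\<^sup>2"
    using o d by (intro power_mono add_mono) auto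
  also have "(?a + ?i)\<^sup>2 \<le> (real A_max + mu_in G)\<^sup>2"
    using a i by (intro power_mono add_mono) auto
  finally have Q: "(Q (Suc t) c n)\<^sup>2 \<le> (Q t c n)\<^sup>2 + (mu_out G + d_max)\<^sup>2
      + (real A_max + mu_in G)\<^sup>2 - 2 * Q t c n * ((?o + d t c n) - (?a + ?i))"
    by simp
  have "D (Suc t) c n \<le> max (D t c n - phi t c n) 0 + d t c n"
    using D_step[OF s] dropped_bounds[OF s, of t] by simp
  then have "(D (Suc t) c n)\<^sup>2 \<le> (max (D t c n - phi t c n) 0 + d t c n)\<^sup>2"
    using D_nonneg[OF s] by (intro power_mono) auto
  also have "\<dots> \<le> (D t c n)\<^sup>2 + (phi t c n)\<^sup>2 + (d t c n)\<^sup>2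
      - 2 * D t c n * (phi t c n - d t c n)"
    using d phi D_nonneg[OF s] by (intro queue_square_drift) auto
  also have "(phi t c n)\<^sup>2 \<le> d_max\<^sup>2" using phi by (intro power_mono) auto
  also have "(d t c n)\<^sup>2 \<le> d_max\<^sup>2" using d by (intro power_mono) auto
  finally have "(D (Suc t) c n)\<^sup>2 \<le> (D t c n)\<^sup>2 + 2 * d_max\<^sup>2
      - 2 * D t c n * (phi t c n - d t c n)"
    by simp
  with Q show ?thesis unfolding drift_const_def by (simp add: algebra_simps)
qed

text \<open>
  Both rules use the full rate exactly when its coefficient is positive, which maximizes a linear
  function over the interval from zero to \<open>d_max\<close>.
\<close>

lemma drop_rules_maximal:
  assumes s: "(c, n) \<in> sources G" and q: "0 \<le> y" "y \<le> d_max"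
  shows "(Q t c n - D t c n) * y \<le> (Q t c n - D t c n) * d t c n"
    and "(D t c n - V * theta c) * y \<le> (D t c n - V * theta c) * phi t c n"
  using q unfolding d_eq[OF s] phi_eq[OF s]
  by (auto intro: mult_left_mono simp: mult_nonpos_nonneg)

text \<open>
  A feasible point discards no more than what reaches the node, so its discard rates compete with
  the drop rates available to the policy.
\<close>

lemma feasible_discard_le:
  assumes feas: "feasible G lam r f q" and s: "(c, n) \<in> sources G"
    and lam: "lam c n \<le> real A_max"
  shows "q c n \<le> d_max"
proof -
  note src = sourceD[OF s]
  have "lam c n + inflow G (f c) n = q c n + outflow G (f c) n"
    using feas s unfolding feasible_def by auto
  moreover have "0 \<le> outflow G (f c) n"
    using feas src by (intro outflow_nonneg) (auto simp: feasible_def)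
  moreover have "inflow G (f c) n \<le> mu_in G"
    using src feasible_flow_le_capacity[OF feas] by (intro inflow_le_mu_in) auto
  ultimately show ?thesis using lam d_max_large by linarith
qed

text \<open>
  The decisions of the policy are replaced by those of the feasible point, at no gain in any of
  the three linear terms. Flow conservation then identifies \<open>q\<close> plus the net outflow of \<open>f\<close> with
  \<open>\<lambda>\<close>.
\<close>

lemma drift_plus_penalty:
  assumes feas: "feasible G lam r f q"
    and lam: "\<And>c n. (c, n) \<in> sources G \<Longrightarrow> lam c n \<le> real A_max"
  shows "(\<Sum>(c, n)\<in>sources G. (Q (Suc t) c n)\<^sup>2 + (D (Suc t) c n)\<^sup>2)
      + 2 * V * (\<Sum>(c, n)\<in>sources G. theta c * phi t c n)
    \<le> (\<Sum>(c, n)\<in>sources G. (Q t c n)\<^sup>2 + (D t c n)\<^sup>2) + real (card (sources G)) * drift_const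
      + 2 * V * (\<Sum>(c, n)\<in>sources G. theta c * q c n)
      + 2 * (\<Sum>(c, n)\<in>sources G. Q t c n * (real (A t c n) - lam c n))"
proof -
  let ?S = "sources G"
  let ?net = "\<lambda>x c n. outflow G (x c) n - inflow G (x c) n"
  have *: "(Q (Suc t) c n)\<^sup>2 + (D (Suc t) c n)\<^sup>2 + 2 * V * (theta c * phi t c n)
      \<le> (Q t c n)\<^sup>2 + (D t c n)\<^sup>2 + drift_const + 2 * V * (theta c * q c n)
        + 2 * (Q t c n * (real (A t c n) - lam c n))
        + 2 * (Q t c n * ?net f c n) - 2 * (Q t c n * ?net (mu t) c n)"
    if s: "(c, n) \<in> ?S" for c n
  proof -
    have q: "0 \<le> q c n" "q c n \<le> d_max"
      using feas s feasible_discard_le[OF feas s lam[OF s]] by (auto simp: feasible_def)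
    have bal: "lam c n = q c n + ?net f c n" using feas s by (auto simp: feasible_def)
    show ?thesis
      using backlog_drift[OF s, of t] drop_rules_maximal[OF s q, of t]
      unfolding bal by (simp add: algebra_simps)
  qed
  have "(\<Sum>(c, n)\<in>?S. (Q (Suc t) c n)\<^sup>2 + (D (Suc t) c n)\<^sup>2 + 2 * V * (theta c * phi t c n))
      \<le> (\<Sum>(c, n)\<in>?S. (Q t c n)\<^sup>2 + (D t c n)\<^sup>2 + drift_const + 2 * V * (theta c * q c n)
        + 2 * (Q t c n * (real (A t c n) - lam c n))
        + 2 * (Q t c n * ?net f c n) - 2 * (Q t c n * ?net (mu t) c n))"
    using * by (intro sum_mono) auto
  then show ?thesis
    using backpressure_net_outflow[OF feas, of t]
    by (simp add: case_prod_unfold sum.distrib sum_subtractf sum_distrib_left[symmetric])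
qed

text \<open>
  Adding the queue updates of a class over its sources makes the internal flows cancel, and the
  data delivered to the destination remain.
\<close>

lemma delivered_eq:
  "(\<Sum>c\<in>classes G. theta c * inflow G (sent t c) (dest G c))
    = (\<Sum>(c, n)\<in>sources G. theta c * (real (A t c n) - dropped t c n + Q t c n - Q (Suc t) c n))"
proof -
  have "theta c * inflow G (sent t c) (dest G c)
      = (\<Sum>n\<in>nodes G - {dest G c}.
          theta c * (real (A t c n) - dropped t c n + Q t c n - Q (Suc t) c n))"
    if c: "c \<in> classes G" for c
  proof -
    have "inflow G (sent t c) (dest G c)
        = (\<Sum>n\<in>nodes G - {dest G c}. outflow G (sent t c) n - inflow G (sent t c) n)"
      using sum_net_inflow_eq_delivered[OF c dest_outflow_sent[OF c]] by simp
    also have "\<dots> = (\<Sum>n\<in>nodes G - {dest G c}.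
        real (A t c n) - dropped t c n + Q t c n - Q (Suc t) c n)"
      using c Q_step[of c _ t] by (intro sum.cong) (auto simp: sources_def)
    finally show ?thesis by (simp add: sum_distrib_left)
  qed
  then show ?thesis unfolding sum_sources by (intro sum.cong) auto
qed

text \<open>
  Squares centred at \<open>V \<theta>\<close> rather than at zero: expanding them produces, besides
  \<open>Q\<^sup>2 + D\<^sup>2\<close>, the linear terms that turn into the growth of \<open>Q\<close>, by which the delivered data
  differ from arrivals minus drops, and the growth of \<open>D\<close>, which bounds the excess of the drops
  over \<open>\<phi>\<close>.
\<close>

definition lyapunov :: "nat \<Rightarrow> real" where
  "lyapunov t = (\<Sum>(c, n)\<in>sources G. (Q t c n - V * theta c)\<^sup>2 + (D t c n - V * theta c)\<^sup>2)"

text \<open>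
  The drift bound controls \<open>\<phi>\<close>, not the drops themselves. They are exchanged at the price of the
  growth of \<open>D\<close>, which together with the growth of \<open>Q\<close> is part of the change of the Lyapunov
  function.
\<close>

lemma delivered_step:
  assumes feas: "feasible G lam r f q"
    and lam: "\<And>c n. (c, n) \<in> sources G \<Longrightarrow> lam c n \<le> real A_max"
  shows "(\<Sum>c\<in>classes G. theta c * inflow G (sent t c) (dest G c))
    \<ge> (\<Sum>(c, n)\<in>sources G. theta c * real (A t c n)) - (\<Sum>(c, n)\<in>sources G. theta c * q c n)
      - real (card (sources G)) * drift_const / (2 * V)
      - (\<Sum>(c, n)\<in>sources G. Q t c n * (real (A t c n) - lam c n)) / V
      + (lyapunov (Suc t) - lyapunov t) / (2 * V)"
proof -
  let ?S = "sources G"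
  have drop: "dropped t c n \<le> phi t c n + D (Suc t) c n - D t c n" if "(c, n) \<in> ?S" for c n
    using D_step[OF that, of t] by simp
  have "lyapunov (Suc t) - lyapunov t
      = (\<Sum>(c, n)\<in>?S. (Q (Suc t) c n)\<^sup>2 + (D (Suc t) c n)\<^sup>2)
        - (\<Sum>(c, n)\<in>?S. (Q t c n)\<^sup>2 + (D t c n)\<^sup>2)
        + 2 * V * (\<Sum>(c, n)\<in>?S. theta c * (Q t c n - Q (Suc t) c n + D t c n - D (Suc t) c n))"
    unfolding lyapunov_def sum_distrib_left sum_subtractf[symmetric] sum.distrib[symmetric]
    by (intro sum.cong) (auto simp: power2_eq_square algebra_simps)
  also have "\<dots> \<le> real (card ?S) * drift_const
      + 2 * V * (\<Sum>(c, n)\<in>?S. theta c * q c n)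
      + 2 * (\<Sum>(c, n)\<in>?S. Q t c n * (real (A t c n) - lam c n))
      - 2 * V * (\<Sum>(c, n)\<in>?S. theta c * phi t c n)
      + 2 * V * (\<Sum>(c, n)\<in>?S. theta c * (Q t c n - Q (Suc t) c n + D t c n - D (Suc t) c n))"
    using drift_plus_penalty[OF feas lam, of t] by simp
  finally have "(lyapunov (Suc t) - lyapunov t) / (2 * V)
      \<le> (real (card ?S) * drift_const
      + 2 * V * (\<Sum>(c, n)\<in>?S. theta c * q c n)
      + 2 * (\<Sum>(c, n)\<in>?S. Q t c n * (real (A t c n) - lam c n))
      - 2 * V * (\<Sum>(c, n)\<in>?S. theta c * phi t c n)
      + 2 * V * (\<Sum>(c, n)\<in>?S. theta c * (Q t c n - Q (Suc t) c n + D t c n - D (Suc t) c n)))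
      / (2 * V)"
    using V_pos by (intro divide_right_mono) auto
  also have "\<dots> = real (card ?S) * drift_const / (2 * V)
      + (\<Sum>(c, n)\<in>?S. theta c * q c n)
      + (\<Sum>(c, n)\<in>?S. Q t c n * (real (A t c n) - lam c n)) / V
      - (\<Sum>(c, n)\<in>?S. theta c * phi t c n)
      + (\<Sum>(c, n)\<in>?S. theta c * (Q t c n - Q (Suc t) c n + D t c n - D (Suc t) c n))"
    using V_pos by (simp add: field_simps)
  finally have step: "(lyapunov (Suc t) - lyapunov t) / (2 * V) \<le> \<dots>" .
  have "(\<Sum>(c, n)\<in>?S. theta c * real (A t c n)) - (\<Sum>(c, n)\<in>?S. theta c * phi t c n)
      + (\<Sum>(c, n)\<in>?S. theta c * (Q t c n - Q (Suc t) c n + D t c n - D (Suc t) c n))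
      = (\<Sum>(c, n)\<in>?S. theta c * (real (A t c n) - (phi t c n + D (Suc t) c n - D t c n)
          + Q t c n - Q (Suc t) c n))"
    unfolding sum_subtractf[symmetric] sum.distrib[symmetric]
    by (intro sum.cong) (auto simp: algebra_simps)
  also have "\<dots> \<le> (\<Sum>(c, n)\<in>?S. theta c * (real (A t c n) - dropped t c n
          + Q t c n - Q (Suc t) c n))"
  proof (intro sum_mono, clarify)
    fix c n assume s: "(c, n) \<in> ?S"
    show "theta c * (real (A t c n) - (phi t c n + D (Suc t) c n - D t c n)
          + Q t c n - Q (Suc t) c n)
        \<le> theta c * (real (A t c n) - dropped t c n + Q t c n - Q (Suc t) c n)"
      using drop[OF s] theta_pos[OF sourceD(1)[OF s]] by (intro mult_left_mono) linarith+
  qed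
  also have "\<dots> = (\<Sum>c\<in>classes G. theta c * inflow G (sent t c) (dest G c))"
    by (rule delivered_eq[symmetric])
  finally show ?thesis using step by linarith
qed

text \<open>
  The Lyapunov function telescopes. Its final value is nonnegative and its initial value is the
  contribution of \<open>Q = 0\<close> and \<open>D = V \<theta>\<close>, whence the constant independent of \<open>T\<close>.
\<close>

lemma delivered_total:
  assumes feas: "feasible G lam r f q"
    and lam: "\<And>c n. (c, n) \<in> sources G \<Longrightarrow> lam c n \<le> real A_max"
  shows "(\<Sum>t<T. \<Sum>c\<in>classes G. theta c * inflow G (sent t c) (dest G c))
    \<ge> (\<Sum>t<T. (\<Sum>(c, n)\<in>sources G. theta c * real (A t c n))
        - (\<Sum>(c, n)\<in>sources G. theta c * q c n)
        - real (card (sources G)) * drift_const / (2 * V)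
        - (\<Sum>(c, n)\<in>sources G. Q t c n * (real (A t c n) - lam c n)) / V)
      - (\<Sum>(c, n)\<in>sources G. V * (theta c)\<^sup>2 / 2)"
proof -
  let ?g = "\<lambda>t. (\<Sum>(c, n)\<in>sources G. theta c * real (A t c n))
        - (\<Sum>(c, n)\<in>sources G. theta c * q c n)
        - real (card (sources G)) * drift_const / (2 * V)
        - (\<Sum>(c, n)\<in>sources G. Q t c n * (real (A t c n) - lam c n)) / V"
  have sums: "(\<Sum>t<T. ?g t) + (lyapunov T - lyapunov 0) / (2 * V)
      \<le> (\<Sum>t<T. \<Sum>c\<in>classes G. theta c * inflow G (sent t c) (dest G c))"
  proof -
    have "(\<Sum>t<T. ?g t + (lyapunov (Suc t) - lyapunov t) / (2 * V))
        \<le> (\<Sum>t<T. \<Sum>c\<in>classes G. theta c * inflow G (sent t c) (dest G c))"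
      by (intro sum_mono delivered_step[OF feas lam])
    moreover have "(\<Sum>t<T. ?g t + (lyapunov (Suc t) - lyapunov t) / (2 * V))
        = (\<Sum>t<T. ?g t) + (lyapunov T - lyapunov 0) / (2 * V)"
      by (simp only: sum.distrib sum_divide_distrib[symmetric] sum_lessThan_telescope)
    ultimately show ?thesis by simp
  qed
  have "lyapunov 0 = 2 * V * (\<Sum>(c, n)\<in>sources G. V * (theta c)\<^sup>2 / 2)"
    unfolding lyapunov_def sum_distrib_left
    by (intro sum.cong) (auto simp: Q_init D_init power2_eq_square)
  moreover have "0 \<le> lyapunov T"
    unfolding lyapunov_def by (intro sum_nonneg) auto
  ultimately have "(lyapunov T - lyapunov 0) / (2 * V)
      \<ge> - (\<Sum>(c, n)\<in>sources G. V * (theta c)\<^sup>2 / 2)"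
    using V_pos by (simp add: pos_le_divide_eq mult.commute)
  with sums show ?thesis by linarith
qed

end


section \<open>Expectations under the policy\<close>

locale ora_policy_pos = ora_policy M G A A_max lam F d_max V theta cs mu sent d dropped phi Q D
  for M :: "'w measure" and G :: "('v, 'c) network_data" and A A_max lam F d_max V theta
    cs mu sent d dropped phi Q D +
  assumes V_pos: "V > 0" and theta_pos: "c \<in> classes G \<Longrightarrow> theta c > 0"
begin

lemma run:
  assumes "\<omega> \<in> space M"
  shows "ora_run G d_max V theta (A \<omega>) (cs \<omega>) (mu \<omega>) (sent \<omega>) (d \<omega>) (dropped \<omega>) (phi \<omega>)
    (Q \<omega>) (D \<omega>) A_max"
  using path[OF assms] V_pos theta_pos A_le[OF assms] d_max_ge
  by (auto simp: ora_run_def ora_run_axioms_def)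

lemma subalgebra_F_Suc: "subalgebra (F (Suc t)) (F t)"
  using sets_F_mono[of t "Suc t"] space_F by (simp add: subalgebra_def)

text \<open>
  The backlogs of a slot are functions of the data sent and the arrivals in earlier slots. Both
  queues go through one induction because the amount dropped compares them.
\<close>

lemma backlogs_adapted:
  "(c, n) \<in> sources G \<Longrightarrow>
    (\<lambda>\<omega>. Q \<omega> t c n) \<in> borel_measurable (F t) \<and> (\<lambda>\<omega>. D \<omega> t c n) \<in> borel_measurable (F t)"
proof (induction t arbitrary: c n)
  case 0
  have "(\<lambda>\<omega>. Q \<omega> 0 c n) \<in> borel_measurable (F 0) \<longleftrightarrow> (\<lambda>\<omega>. 0::real) \<in> borel_measurable (F 0)"
    using ora_path.Q_init[OF path 0] by (intro measurable_cong) (simp add: space_F)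
  moreover have "(\<lambda>\<omega>. D \<omega> 0 c n) \<in> borel_measurable (F 0)
      \<longleftrightarrow> (\<lambda>\<omega>. V * theta c) \<in> borel_measurable (F 0)"
    using ora_path.D_init[OF path 0] by (intro measurable_cong) (simp add: space_F)
  ultimately show ?case by simp
next
  case (Suc t)
  note s = Suc.prems
  have c: "c \<in> classes G" using s by (auto simp: sources_def)
  have up: "f \<in> borel_measurable (F (Suc t))" if "f \<in> borel_measurable (F t)"
    for f :: "'w \<Rightarrow> real"
    using measurable_from_subalg[OF subalgebra_F_Suc that] .
  have [measurable]: "(\<lambda>\<omega>. Q \<omega> t c n) \<in> borel_measurable (F (Suc t))"
    "(\<lambda>\<omega>. D \<omega> t c n) \<in> borel_measurable (F (Suc t))"
    using Suc.IH[OF s] by (simp_all add: up)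
  have [measurable]: "(\<lambda>\<omega>. outflow G (sent \<omega> t c) n) \<in> borel_measurable (F (Suc t))"
    "(\<lambda>\<omega>. inflow G (sent \<omega> t c) n) \<in> borel_measurable (F (Suc t))"
    unfolding outflow_def inflow_def
    by (intro borel_measurable_sum up sent_adapted c; simp)+
  have [measurable]: "(\<lambda>\<omega>. A \<omega> t c n) \<in> measurable (F (Suc t)) (count_space UNIV)"
    using A_past[OF s] .
  define dr where "dr = (\<lambda>\<omega>. min (Q \<omega> t c n - outflow G (sent \<omega> t c) n)
    (if Q \<omega> t c n > D \<omega> t c n then d_max else 0))"
  have [measurable]: "dr \<in> borel_measurable (F (Suc t))" unfolding dr_def by measurable
  have dr: "dropped \<omega> t c n = dr \<omega>" if "\<omega> \<in> space M" for \<omega>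
    unfolding dr_def ora_run.dropped_eq_sent[OF run[OF that] s]
      ora_path.d_eq[OF path[OF that] s] ..
  have "(\<lambda>\<omega>. Q \<omega> (Suc t) c n) \<in> borel_measurable (F (Suc t))
    \<longleftrightarrow> (\<lambda>\<omega>. Q \<omega> t c n - outflow G (sent \<omega> t c) n - dr \<omega> + real (A \<omega> t c n)
          + inflow G (sent \<omega> t c) n) \<in> borel_measurable (F (Suc t))"
    using ora_path.Q_step[OF path s] dr by (intro measurable_cong) (simp add: space_F)
  moreover have "(\<lambda>\<omega>. D \<omega> (Suc t) c n) \<in> borel_measurable (F (Suc t))
    \<longleftrightarrow> (\<lambda>\<omega>. max (D \<omega> t c n - (if D \<omega> t c n > V * theta c then d_max else 0)) 0 + dr \<omega>)
          \<in> borel_measurable (F (Suc t))"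
    using ora_path.D_step[OF path s] ora_path.phi_eq[OF path s] dr
    by (intro measurable_cong) (simp add: space_F)
  ultimately show ?case by simp
qed

lemma A_measurable:
  "(c, n) \<in> sources G \<Longrightarrow> (\<lambda>\<omega>. real (A \<omega> t c n)) \<in> borel_measurable M"
  using measurable_from_subalg[OF F_subalgebra A_past[of c n t]] by simp

lemma integrable_A: "(c, n) \<in> sources G \<Longrightarrow> integrable M (\<lambda>\<omega>. real (A \<omega> t c n))"
  using A_le A_measurable
  by (intro integrable_const_bound[of _ "real A_max"] AE_I2) auto

lemma lam_le: "(c, n) \<in> sources G \<Longrightarrow> lam c n \<le> real A_max"
  using integral_le_const[OF integrable_A[of c n 0], of "real A_max"] A_le A_mean[of c n 0] by auto

lemma Q_measurable: "(c, n) \<in> sources G \<Longrightarrow> (\<lambda>\<omega>. Q \<omega> t c n) \<in> borel_measurable M"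
  using measurable_from_subalg[OF F_subalgebra] backlogs_adapted by blast

lemma integrable_Q: "(c, n) \<in> sources G \<Longrightarrow> integrable M (\<lambda>\<omega>. Q \<omega> t c n)"
  using ora_run.Q_le[OF run] ora_run.Q_nonneg[OF run] Q_measurable
  by (intro integrable_const_bound[of _ "real t * d_max"] AE_I2) auto

text \<open>
  The arrivals of a slot are independent of the past jointly, as one random vector over all
  sources. A single arrival is a coordinate of this vector and the backlog belongs to the past, so
  independence passes to the smaller sigma-algebras that they generate.
\<close>

lemma indep_Q_A:
  assumes s: "(c, n) \<in> sources G"
  shows "indep_var borel (\<lambda>\<omega>. Q \<omega> t c n) borel (\<lambda>\<omega>. real (A \<omega> t c n))"
proof -
  let ?X = "\<lambda>\<omega>. restrict (\<lambda>(c, n). A \<omega> t c n) (sources G)"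
  let ?P = "\<Pi>\<^sub>M _\<in>sources G. count_space (UNIV :: nat set)"
  let ?VA = "vimage_algebra (space M) ?X ?P"
  have "?X \<in> measurable ?VA ?P"
    by (rule measurable_vimage_algebra1) (auto simp: space_PiM)
  then have "(\<lambda>\<omega>. real (?X \<omega> (c, n))) \<in> borel_measurable ?VA"
    by (rule measurable_compose[OF _ measurable_PiM_component_rev[OF s]]) simp
  then have A: "(\<lambda>\<omega>. real (A \<omega> t c n)) \<in> borel_measurable ?VA" using s by simp
  have Q: "(\<lambda>\<omega>. Q \<omega> t c n) \<in> borel_measurable (F t)" using backlogs_adapted[OF s] by simp
  have "sigma_sets (space M) {(\<lambda>\<omega>. Q \<omega> t c n) -` B \<inter> space M | B. B \<in> sets borel} \<subseteq> sets (F t)"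
    using measurable_sets[OF Q] unfolding space_F[of t, symmetric]
    by (intro sets.sigma_sets_subset) auto
  moreover have "sigma_sets (space M) {(\<lambda>\<omega>. real (A \<omega> t c n)) -` B \<inter> space M | B. B \<in> sets borel}
      \<subseteq> sets ?VA"
    using measurable_sets[OF A, unfolded space_vimage_algebra]
    by (intro sets.sigma_sets_subset[of _ ?VA, unfolded space_vimage_algebra]) auto
  ultimately have "indep_set
      (sigma_sets (space M) {(\<lambda>\<omega>. Q \<omega> t c n) -` B \<inter> space M | B. B \<in> sets borel})
      (sigma_sets (space M) {(\<lambda>\<omega>. real (A \<omega> t c n)) -` B \<inter> space M | B. B \<in> sets borel})"
    using A_indep_past[of t] unfolding indep_set_def
    by (elim indep_sets_mono_sets) (auto split: bool.split)
  then show ?thesis unfolding indep_var_eq using Q_measurable[OF s] A_measurable[OF s] by simp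
qed

text \<open>
  By independence the expectation factors, and the arrivals have mean \<open>\<lambda>\<close>. This is where the
  nonanticipating choice of routes and tie-breaking enters.
\<close>

lemma backlog_arrival_cross_term:
  assumes s: "(c, n) \<in> sources G"
  shows "integrable M (\<lambda>\<omega>. Q \<omega> t c n * (real (A \<omega> t c n) - lam c n))"
    and "expectation (\<lambda>\<omega>. Q \<omega> t c n * (real (A \<omega> t c n) - lam c n)) = 0"
proof -
  note * = indep_Q_A[OF s, of t] integrable_Q[OF s, of t] integrable_A[OF s, of t]
  have int: "integrable M (\<lambda>\<omega>. Q \<omega> t c n * real (A \<omega> t c n))"
    using indep_var_integrable[OF *] .
  then show "integrable M (\<lambda>\<omega>. Q \<omega> t c n * (real (A \<omega> t c n) - lam c n))"
    using *(2) by (simp add: right_diff_distrib)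
  show "expectation (\<lambda>\<omega>. Q \<omega> t c n * (real (A \<omega> t c n) - lam c n)) = 0"
    using int *(2) indep_var_lebesgue_integral[OF *] A_mean[OF s, of t]
    by (simp add: right_diff_distrib)
qed

lemma integrable_delivered:
  assumes c: "c \<in> classes G"
  shows "integrable M (\<lambda>\<omega>. inflow G (sent \<omega> t c) (dest G c))"
proof -
  have "integrable M (\<lambda>\<omega>. sent \<omega> t c l)" if l: "l \<in> links G" for l
    using measurable_from_subalg[OF F_subalgebra sent_adapted[OF l c]]
      ora_run.sent_le_capacity[OF run l c] ora_path.sent_bounds[OF path l c]
    by (intro integrable_const_bound[of _ "capacity G l"] AE_I2) auto
  then show ?thesis unfolding inflow_def by (intro Bochner_Integration.integrable_sum) auto
qed

text \<open>
  Integrating \<open>delivered_total\<close> removes the noise, and by the definition of \<open>r\<close> in the throughput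
  problem the arrival rates minus the discard rates \<open>q\<close> add up to the weighted throughput.
\<close>

lemma expected_delivered_ge:
  assumes feas: "feasible G lam r f q"
  shows "(\<Sum>t<T. \<Sum>c\<in>classes G. theta c * expectation (\<lambda>\<omega>. inflow G (sent \<omega> t c) (dest G c)))
    \<ge> real T * ((\<Sum>c\<in>classes G. theta c * r c) - ora_gap G A_max d_max / (2 * V))
      - (\<Sum>(c, n)\<in>sources G. V * (theta c)\<^sup>2 / 2)"
proof -
  let ?S = "sources G"
  define \<beta> where "\<beta> = (mu_out G + d_max)\<^sup>2 + (real A_max + mu_in G)\<^sup>2 + 2 * d_max\<^sup>2"
  define B where "B = real (card ?S) * \<beta> / (2 * V)"
  define qq where "qq = (\<Sum>(c, n)\<in>?S. theta c * q c n)"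
  define K where "K = (\<Sum>(c, n)\<in>?S. V * (theta c)\<^sup>2 / 2)"
  have const: "has_bochner_integral M (\<lambda>_. x) x" for x :: real
    by (simp add: has_bochner_integral_iff prob_space)
  have step: "has_bochner_integral M
      (\<lambda>\<omega>. (\<Sum>(c, n)\<in>?S. theta c * real (A \<omega> t c n)) - qq - B
        - (\<Sum>(c, n)\<in>?S. Q \<omega> t c n * (real (A \<omega> t c n) - lam c n)) / V)
      ((\<Sum>(c, n)\<in>?S. theta c * lam c n) - qq - B - (\<Sum>(c, n)\<in>?S. 0) / V)" for t
  proof (intro has_bochner_integral_diff[OF has_bochner_integral_diff[OF has_bochner_integral_diff]]
      has_bochner_integral_divide_zero const has_bochner_integral_sum, goal_cases)
    case (1 s)
    then show ?case
      using integrable_A[of "fst s" "snd s" t] A_mean[of "fst s" "snd s" t]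
      by (cases s) (auto simp: has_bochner_integral_iff)
  next
    case (2 s)
    then show ?case
      using backlog_arrival_cross_term[of "fst s" "snd s" t]
      by (cases s) (auto simp: has_bochner_integral_iff)
  qed
  have low: "has_bochner_integral M
      (\<lambda>\<omega>. (\<Sum>t<T. (\<Sum>(c, n)\<in>?S. theta c * real (A \<omega> t c n)) - qq - B
        - (\<Sum>(c, n)\<in>?S. Q \<omega> t c n * (real (A \<omega> t c n) - lam c n)) / V) - K)
      ((\<Sum>t<T. (\<Sum>(c, n)\<in>?S. theta c * lam c n) - qq - B - (\<Sum>(c, n)\<in>?S. 0) / V) - K)"
    by (intro has_bochner_integral_diff has_bochner_integral_sum step const)
  have recv: "has_bochner_integral M
      (\<lambda>\<omega>. \<Sum>t<T. \<Sum>c\<in>classes G. theta c * inflow G (sent \<omega> t c) (dest G c))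
      (\<Sum>t<T. \<Sum>c\<in>classes G. theta c * expectation (\<lambda>\<omega>. inflow G (sent \<omega> t c) (dest G c)))"
    by (intro has_bochner_integral_sum has_bochner_integral_mult_right
        has_bochner_integral_integrable integrable_delivered)
  have "(\<Sum>t<T. (\<Sum>(c, n)\<in>?S. theta c * real (A \<omega> t c n)) - qq - B
        - (\<Sum>(c, n)\<in>?S. Q \<omega> t c n * (real (A \<omega> t c n) - lam c n)) / V) - K
      \<le> (\<Sum>t<T. \<Sum>c\<in>classes G. theta c * inflow G (sent \<omega> t c) (dest G c))"
    if w: "\<omega> \<in> space M" for \<omega>
    using ora_run.delivered_total[OF run[OF w] feas lam_le, of T]
    unfolding ora_run.drift_const_def[OF run[OF w]] B_def \<beta>_def qq_def K_def .
  then have le: "(\<Sum>t<T. (\<Sum>(c, n)\<in>?S. theta c * lam c n) - qq - B - (\<Sum>(c, n)\<in>?S. 0) / V) - K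
      \<le> (\<Sum>t<T. \<Sum>c\<in>classes G. theta c * expectation (\<lambda>\<omega>. inflow G (sent \<omega> t c) (dest G c)))"
    unfolding has_bochner_integral_integral_eq[OF low, symmetric]
      has_bochner_integral_integral_eq[OF recv, symmetric]
    by (rule integral_mono[OF integrable.intros[OF low] integrable.intros[OF recv]])
  have opt: "(\<Sum>(c, n)\<in>?S. theta c * lam c n) - qq = (\<Sum>c\<in>classes G. theta c * r c)"
  proof -
    have "(\<Sum>(c, n)\<in>?S. theta c * lam c n) - qq
        = (\<Sum>c\<in>classes G. \<Sum>n\<in>nodes G - {dest G c}. theta c * (lam c n - q c n))"
      unfolding qq_def sum_sources[symmetric]
      by (simp add: case_prod_unfold sum_subtractf right_diff_distrib)
    also have "\<dots> = (\<Sum>c\<in>classes G. theta c * r c)"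
      using feas unfolding feasible_def
      by (intro sum.cong) (auto simp: sum_distrib_left[symmetric] sum_subtractf)
    finally show ?thesis .
  qed
  have *: "real T * ((\<Sum>c\<in>classes G. theta c * r c) - B) - K
    \<le> (\<Sum>t<T. \<Sum>c\<in>classes G. theta c * expectation (\<lambda>\<omega>. inflow G (sent \<omega> t c) (dest G c)))"
    using le unfolding opt by simp
  have "B \<le> ora_gap G A_max d_max / (2 * V)"
  proof -
    have "real (card ?S) \<le> real (card (nodes G)) * real (card (classes G))"
      using card_sources_le by (metis of_nat_le_iff of_nat_mult)
    moreover have "0 \<le> \<beta>" unfolding \<beta>_def by simp
    ultimately show ?thesis
      unfolding B_def ora_gap_def \<beta>_def[symmetric] using V_pos
      by (intro divide_right_mono mult_right_mono) auto
  qed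
  then have "real T * ((\<Sum>c\<in>classes G. theta c * r c) - ora_gap G A_max d_max / (2 * V))
      \<le> real T * ((\<Sum>c\<in>classes G. theta c * r c) - B)"
    by (intro mult_left_mono) auto
  with * show ?thesis unfolding K_def by linarith
qed

text \<open>
  The constant in \<open>expected_delivered_ge\<close> vanishes after division by the horizon.
\<close>

lemma throughput_ge_half_gap:
  assumes conv: "\<And>c. c \<in> classes G \<Longrightarrow> convergent (avg_throughput M G sent c)"
    and feas: "feasible G lam r f q"
  shows "(\<Sum>c\<in>classes G. theta c * throughput M G sent c)
    \<ge> (\<Sum>c\<in>classes G. theta c * r c) - ora_gap G A_max d_max / (2 * V)"
proof -
  define K where "K = (\<Sum>(c, n)\<in>sources G. V * (theta c)\<^sup>2 / 2)"
  define R where "R = (\<Sum>c\<in>classes G. theta c * r c) - ora_gap G A_max d_max / (2 * V)"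
  have lim: "(\<lambda>T. \<Sum>c\<in>classes G. theta c * avg_throughput M G sent c T)
      \<longlonglongrightarrow> (\<Sum>c\<in>classes G. theta c * throughput M G sent c)"
    unfolding throughput_def using conv by (intro tendsto_intros) (simp add: convergent_LIMSEQ_iff)
  have "R - K / real T \<le> (\<Sum>c\<in>classes G. theta c * avg_throughput M G sent c T)"
    if T: "T \<ge> 1" for T
  proof -
    have "R - K / real T = (real T * R - K) / real T" using T by (simp add: field_simps)
    also have "\<dots> \<le> (\<Sum>t<T. \<Sum>c\<in>classes G.
        theta c * expectation (\<lambda>\<omega>. inflow G (sent \<omega> t c) (dest G c))) / real T"
      using expected_delivered_ge[OF feas, of T] T unfolding K_def R_def
      by (intro divide_right_mono) auto
    also have "\<dots> = (\<Sum>c\<in>classes G. theta c * avg_throughput M G sent c T)"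
      by (subst sum.swap) (simp add: avg_throughput_def sum_distrib_left sum_divide_distrib)
    finally show ?thesis .
  qed
  moreover have "(\<lambda>T. R - K / real T) \<longlonglongrightarrow> R"
    using tendsto_diff[OF tendsto_const[of R] lim_const_over_n[of K]] by simp
  ultimately show ?thesis
    unfolding R_def[symmetric] by (intro LIMSEQ_le[OF _ lim]) auto
qed

end


section \<open>Throughput of the policy\<close>

theorem theorem1:
  fixes M :: "'w measure"
    and G :: "('v, 'c) network_data"
    and A :: "'w \<Rightarrow> nat \<Rightarrow> 'c \<Rightarrow> 'v \<Rightarrow> nat"
    and A_max :: nat
    and lam :: "'c \<Rightarrow> 'v \<Rightarrow> real"
    and F :: "nat \<Rightarrow> 'w measure"
    and d_max V :: real
    and a r :: "'c \<Rightarrow> real"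
    and cs :: "'w \<Rightarrow> nat \<Rightarrow> 'v \<times> 'v \<Rightarrow> 'c"
    and mu sent :: "'w \<Rightarrow> nat \<Rightarrow> 'c \<Rightarrow> 'v \<times> 'v \<Rightarrow> real"
    and d dropped phi Q D :: "'w \<Rightarrow> nat \<Rightarrow> 'c \<Rightarrow> 'v \<Rightarrow> real"
  assumes "\<And>c. c \<in> classes G \<Longrightarrow> a c > 0"
    and "V > 0"
    and "ora_policy M G A A_max lam F d_max V a cs mu sent d dropped phi Q D"
    and "\<And>c. c \<in> classes G \<Longrightarrow> convergent (avg_throughput M G sent c)"
    and "optimal_throughput G lam a r"
  shows "(\<Sum>c\<in>classes G. a c * throughput M G sent c)
    \<ge> (\<Sum>c\<in>classes G. a c * r c) - ora_gap G A_max d_max / V"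
proof -
  interpret ora_policy_pos M G A A_max lam F d_max V a cs mu sent d dropped phi Q D
    using assms(1-3) by (simp add: ora_policy_pos_def ora_policy_pos_axioms_def)
  obtain f q where feas: "feasible G lam r f q"
    using assms(5) by (auto simp: optimal_throughput_def is_arg_max_def)
  have "0 \<le> ora_gap G A_max d_max" by (simp add: ora_gap_def)
  then have "ora_gap G A_max d_max / (2 * V) \<le> ora_gap G A_max d_max / V"
    using \<open>V > 0\<close> by (intro divide_left_mono) auto
  then show ?thesis using throughput_ge_half_gap[OF assms(4) feas] by linarith
qed

end
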